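(* Let $\Gamma$ be an $\mathbf{F}_2^\mu$ environment, $e$ a Curry-style evidence and $T$ a type, where all types involved are well-kinded, of the form described below, and contain no existential variables. If $\{(\Gamma, e, T)\} \longrightarrow^* \emptyset$ by resolution by second-order matching (RSM), then there exists an evidence $e'$ such that $\Gamma \vdash e' : T$ in $\mathbf{F}_2^\mu$ and $|e'| = e$.
   Context: System $\mathbf{F}_2^\mu$: evidence $e ::= \alpha \mid \kappa \mid \lambda\alpha.e \mid e\,e' \mid \mu\alpha.e \mid e\,T \mid \lambda x.e$; term kinds $K::=*\mid*\Rightarrow K$; types $T ::= F \mid x \mid \lambda x.T \mid \forall x{:}K.T \mid T\,T' \mid T \Rightarrow T'$, required to be well-kinded (a type $\lambda x.T$ must have $x\in\mathrm{FV}(T)$, applications $T_2T_1$ need $T_1:*$, $T_2:*\Rightarrow K$, and $\forall$, $\Rightarrow$ form types of kind $o$). Typing rules: declared variables/constants; (App) from $e_1:T'$, $e_2:T'\Rightarrow T$ infer $e_2e_1:T$; (Lam) from $\Gamma,\alpha:T'\vdash e:T$ infer $\lambda\alpha.e:T'\Rightarrow T$; (Mu) from $\Gamma,\alpha:T\vdash e:T$ infer $\mu\alpha.e:T$; (Inst) from $e:\forall x{:}K.T$ infer $e\,T':[T'/x]T$; (Abs) from $e:T$, $x\notin\mathrm{FV}(\Gamma)$ infer $\lambda x.e:\forall x{:}K.T$; (Conv) types up to $\leftrightarrow_o^*$, $\to_o$ the compatible closure of $(\lambda x.T)T'\to_o[T'/x]T$. Erasure $|\cdot|$ deletes type abstractions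 $\lambda x.$ and type applications $e\,T$; a Curry-style evidence is one of the form $|e|$, i.e. built from $\alpha,\kappa,\lambda\alpha.e,e\,e',\mu\alpha.e$. Types are considered in the form $T ::= A \mid \forall\underline{x}.\,T_1\Rightarrow\cdots\Rightarrow T_n\Rightarrow A$ where $A$ has kind $*$ (the head). For $T=\forall x_1\ldots x_m.\,T_1,\ldots,T_n\Rightarrow A$, the existential variables are the $x_i$ not free in $A$ together with the free variables of $T$. Second-order matching of $A\mapsto B$ transforms sets of problems: $\{F\,\underline{A}\mapsto G\,\underline{B},E\}$ with distinct constants $F\neq G$ fails; $\{a\,A_1\ldots A_n\mapsto a\,B_1\ldots B_n,E\}$ becomes $\{A_1\mapsto B_1,\ldots,A_n\mapsto B_n,E\}$; for a variable $y$ and problem set $E'=\{y\,A_1\ldots A_n\mapsto a\,B_1\ldots B_m,E\}$ one may apply (Proj) $[\lambda x_1\ldots\lambda x_n.x_i/y]E'$ or (Imi) $[\lambda x_1\ldots\lambda x_n.\,a\,(y_1\underline{x})\cdots(y_m\underline{x})/y]E'$ with fresh $y_j$; $B\mapsto_\sigma A$ means some derivation reaches $\emptyset$ with accumulated substitution $\sigma$, restricted to well-kinded substitutions. RSM transforms finite sets $\Phi$ of triples $(\Gamma,e,T)$: (1) $\{(\Gamma,h\,e_1\cdots e_n,A),\Phi\}\longrightarrow\{(\Gamma,e_1,\sigma T_1),\ldots,(\Gamma,e_n,\sigma T_n),\Phi\}$ if $h$ is an evidence variable or constant with $h:\forall\underline{x}.\,T_1,\ldots,T_n\Rightarrow B\in\Gamma$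 (bound variables renamed fresh) and $B\mapsto_\sigma A$ ($n\ge0$); (2) $\{(\Gamma,\lambda\alpha_1\ldots\lambda\alpha_n.e,\ T_1,\ldots,T_n\Rightarrow A),\Phi\}\longrightarrow\{(\Gamma,\alpha_1:T_1,\ldots,\alpha_n:T_n,\ e,A),\Phi\}$ ($n\ge1$); (3) $\{(\Gamma,e,\forall x_1\ldots x_n.T),\Phi\}\longrightarrow\{(\Gamma,e,T),\Phi\}$ ($n\ge1$, the $x_i$ becoming fresh eigenvariables treated as constants); (4) $\{(\Gamma,\mu\alpha.e,T),\Phi\}\longrightarrow\{(\Gamma,\alpha:T,\ e,T),\Phi\}$. *)

theory Defs
  imports Main
begin

datatype kind = Star | KFun kind  \<comment> \<open>\<open>KFun K\<close> is \<open>* \<Rightarrow> K\<close>\<close>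

text \<open>
  Type constants and type variables carry their kind, so kinding needs no signature or
  kinding context: there are infinitely many symbols of every kind.
\<close>

type_synonym tsym = "string \<times> kind"

text \<open>
  Variables are named when free and de Bruijn indices when bound, so equality of types is
  alpha-equivalence. Below, \<open>\<lambda>x. T\<close> and \<open>\<forall>x. T\<close> are always written \<open>tlam x T\<close> and \<open>tall x T\<close>,
  with a named \<open>x\<close>. The argument of a \<open>\<lambda>\<close> always has kind \<open>*\<close>.
\<close>

datatype ty =
    TCon tsym
  | TFree tsym
  | TBound nat
  | TLam ty
  | TAll kind ty
  | TApp ty ty
  | TImp ty ty

primrec fv :: "ty \<Rightarrow> tsym set" where
  "fv (TCon F) = {}"
| "fv (TFree x) = {x}"
| "fv (TBound i) = {}"
| "fv (TLam T) = fv T"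
| "fv (TAll K T) = fv T"
| "fv (TApp T U) = fv T \<union> fv U"
| "fv (TImp T U) = fv T \<union> fv U"

primrec tlift :: "nat \<Rightarrow> ty \<Rightarrow> ty" where
  "tlift k (TCon F) = TCon F"
| "tlift k (TFree x) = TFree x"
| "tlift k (TBound i) = TBound (if i < k then i else Suc i)"
| "tlift k (TLam T) = TLam (tlift (Suc k) T)"
| "tlift k (TAll K T) = TAll K (tlift (Suc k) T)"
| "tlift k (TApp T U) = TApp (tlift k T) (tlift k U)"
| "tlift k (TImp T U) = TImp (tlift k T) (tlift k U)"

text \<open>\<open>tabs k x T\<close> turns the free name \<open>x\<close> into the index \<open>k\<close>, making room for that index.\<close>

primrec tabs :: "nat \<Rightarrow> tsym \<Rightarrow> ty \<Rightarrow> ty" where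
  "tabs k x (TCon F) = TCon F"
| "tabs k x (TFree y) = (if y = x then TBound k else TFree y)"
| "tabs k x (TBound i) = TBound (if i < k then i else Suc i)"
| "tabs k x (TLam T) = TLam (tabs (Suc k) x T)"
| "tabs k x (TAll K T) = TAll K (tabs (Suc k) x T)"
| "tabs k x (TApp T U) = TApp (tabs k x T) (tabs k x U)"
| "tabs k x (TImp T U) = TImp (tabs k x T) (tabs k x U)"

definition tlam :: "tsym \<Rightarrow> ty \<Rightarrow> ty" where
  "tlam x T = TLam (tabs 0 x T)"

definition tall :: "tsym \<Rightarrow> ty \<Rightarrow> ty" where
  "tall x T = TAll (snd x) (tabs 0 x T)"

definition tlams :: "tsym list \<Rightarrow> ty \<Rightarrow> ty" where
  "tlams xs T = foldr tlam xs T"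

definition talls :: "tsym list \<Rightarrow> ty \<Rightarrow> ty" where
  "talls xs T = foldr tall xs T"

definition timps :: "ty list \<Rightarrow> ty \<Rightarrow> ty" where
  "timps Ts A = foldr TImp Ts A"

definition tapps :: "ty \<Rightarrow> ty list \<Rightarrow> ty" where
  "tapps T Ts = foldl TApp T Ts"

primrec tsubst :: "(tsym \<Rightarrow> ty) \<Rightarrow> ty \<Rightarrow> ty" where
  "tsubst \<sigma> (TCon F) = TCon F"
| "tsubst \<sigma> (TFree x) = \<sigma> x"
| "tsubst \<sigma> (TBound i) = TBound i"
| "tsubst \<sigma> (TLam T) = TLam (tsubst (\<lambda>x. tlift 0 (\<sigma> x)) T)"
| "tsubst \<sigma> (TAll K T) = TAll K (tsubst (\<lambda>x. tlift 0 (\<sigma> x)) T)"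
| "tsubst \<sigma> (TApp T U) = TApp (tsubst \<sigma> T) (tsubst \<sigma> U)"
| "tsubst \<sigma> (TImp T U) = TImp (tsubst \<sigma> T) (tsubst \<sigma> U)"

inductive beta :: "ty \<Rightarrow> ty \<Rightarrow> bool" where
  "beta (TApp (tlam x T) U) (tsubst (TFree(x := U)) T)"
| "beta T T' \<Longrightarrow> beta (tlam x T) (tlam x T')"
| "beta T T' \<Longrightarrow> beta (tall x T) (tall x T')"
| "beta T T' \<Longrightarrow> beta (TApp T U) (TApp T' U)"
| "beta U U' \<Longrightarrow> beta (TApp T U) (TApp T U')"
| "beta T T' \<Longrightarrow> beta (TImp T U) (TImp T' U)"
| "beta U U' \<Longrightarrow> beta (TImp T U) (TImp T U')"

datatype tykind = Omicron | Tm kind  \<comment> \<open>the kind \<open>o\<close>, and the term kinds\<close>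

inductive kinded :: "ty \<Rightarrow> tykind \<Rightarrow> bool" where
  "kinded (TCon F) (Tm (snd F))"
| "kinded (TFree x) (Tm (snd x))"
| "\<lbrakk>kinded T (Tm K); snd x = Star; x \<in> fv T\<rbrakk> \<Longrightarrow> kinded (tlam x T) (Tm (KFun K))"
| "\<lbrakk>kinded T (Tm (KFun K)); kinded U (Tm Star)\<rbrakk> \<Longrightarrow> kinded (TApp T U) (Tm K)"
| "\<lbrakk>kinded T k; k \<in> {Omicron, Tm Star}\<rbrakk> \<Longrightarrow> kinded (tall x T) Omicron"
| "\<lbrakk>kinded T k; k \<in> {Omicron, Tm Star}; kinded U l; l \<in> {Omicron, Tm Star}\<rbrakk>
    \<Longrightarrow> kinded (TImp T U) Omicron"

definition well_kinded :: "ty \<Rightarrow> bool" where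
  "well_kinded T \<longleftrightarrow> kinded T Omicron \<or> kinded T (Tm Star)"

inductive rule_form :: "ty \<Rightarrow> bool" where
  "\<lbrakk>\<forall>T \<in> set Ts. rule_form T; kinded A (Tm Star)\<rbrakk> \<Longrightarrow> rule_form (talls xs (timps Ts A))"

definition exvars :: "tsym list \<Rightarrow> ty list \<Rightarrow> ty \<Rightarrow> tsym set" where
  "exvars xs Ts A = {x \<in> set xs. x \<notin> fv A} \<union> fv (talls xs (timps Ts A))"

text \<open>
  Since the head \<open>A\<close> has kind \<open>*\<close>, the decomposition is unique up to renaming of \<open>xs\<close>.
\<close>

definition no_exvars :: "ty \<Rightarrow> bool" where
  "no_exvars T \<longleftrightarrow> (\<exists>xs Ts A. T = talls xs (timps Ts A) \<and> distinct xs \<and>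
     kinded A (Tm Star) \<and> exvars xs Ts A = {})"

datatype esym = EVar string | ECon string

datatype ev =
    Sym esym
  | Lam string ev
  | App ev ev
  | Mu string ev
  | Inst ev ty
  | Abs tsym ev

text \<open>The most recent declaration comes first and shadows earlier ones.\<close>

type_synonym env = "(esym \<times> ty) list"

definition fvenv :: "env \<Rightarrow> tsym set" where
  "fvenv \<Gamma> = (\<Union>(h, T) \<in> set \<Gamma>. fv T)"

text \<open>
  Evidence is raw named syntax: no rule substitutes into evidence, and shadowing in the
  environment follows the scoping of \<open>Lam\<close> and \<open>Mu\<close>.
\<close>

inductive typing :: "env \<Rightarrow> ev \<Rightarrow> ty \<Rightarrow> bool" where
  t_sym: "map_of \<Gamma> h = Some T \<Longrightarrow> typing \<Gamma> (Sym h) T"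
| t_app: "\<lbrakk>typing \<Gamma> e1 T'; typing \<Gamma> e2 (TImp T' T)\<rbrakk> \<Longrightarrow> typing \<Gamma> (App e2 e1) T"
| t_lam: "\<lbrakk>typing ((EVar a, T') # \<Gamma>) e T; well_kinded T'\<rbrakk> \<Longrightarrow> typing \<Gamma> (Lam a e) (TImp T' T)"
| t_mu: "\<lbrakk>typing ((EVar a, T) # \<Gamma>) e T; well_kinded T\<rbrakk> \<Longrightarrow> typing \<Gamma> (Mu a e) T"
| t_inst: "\<lbrakk>typing \<Gamma> e (tall x T); kinded T' (Tm (snd x))\<rbrakk>
    \<Longrightarrow> typing \<Gamma> (Inst e T') (tsubst (TFree(x := T')) T)"
| t_abs: "\<lbrakk>typing \<Gamma> e T; x \<notin> fvenv \<Gamma>\<rbrakk> \<Longrightarrow> typing \<Gamma> (Abs x e) (tall x T)"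
| t_conv: "\<lbrakk>typing \<Gamma> e T; equivclp beta T T'; well_kinded T'\<rbrakk> \<Longrightarrow> typing \<Gamma> e T'"

primrec erase :: "ev \<Rightarrow> ev" where
  "erase (Sym h) = Sym h"
| "erase (Lam a e) = Lam a (erase e)"
| "erase (App e1 e2) = App (erase e1) (erase e2)"
| "erase (Mu a e) = Mu a (erase e)"
| "erase (Inst e T) = erase e"
| "erase (Abs x e) = erase e"

definition curry_style :: "ev \<Rightarrow> bool" where
  "curry_style e \<longleftrightarrow> (\<exists>e'. e = erase e')"

definition apps :: "ev \<Rightarrow> ev list \<Rightarrow> ev" where
  "apps e es = foldl App e es"

definition lams :: "string list \<Rightarrow> ev \<Rightarrow> ev" where
  "lams as e = foldr Lam as e"

definition atom :: "ty \<Rightarrow> bool" where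
  "atom a \<longleftrightarrow> (\<exists>F. a = TCon F) \<or> (\<exists>x. a = TFree x)"

text \<open>A state is \<open>(V, E, \<rho>)\<close>: the matching variables introduced so far, the problems
  (pattern, target), and the accumulated substitution. The variables in \<open>R\<close> are rigid, i.e.
  treated as constants. A clash of distinct constant heads fails because no rule ever
  removes such a problem. The two last rules compute beta-reducts, since the other rules
  speak about normal forms while substitution creates redexes.\<close>

type_synonym mstate = "tsym set \<times> (ty \<times> ty) set \<times> (tsym \<Rightarrow> ty)"

definition bind :: "(tsym \<Rightarrow> ty) \<Rightarrow> (ty \<times> ty) set \<Rightarrow> (ty \<times> ty) set" where
  "bind \<theta> E = (\<lambda>(l, r). (tsubst \<theta> l, tsubst \<theta> r)) ` E"

inductive match_step :: "tsym set \<Rightarrow> mstate \<Rightarrow> mstate \<Rightarrow> bool" for R :: "tsym set" where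
  m_decompose: "\<lbrakk>atom a; length As = length Bs\<rbrakk> \<Longrightarrow>
    match_step R (V, insert (tapps a As, tapps a Bs) E, \<rho>) (V, set (zip As Bs) \<union> E, \<rho>)"
| m_proj: "\<lbrakk>E' = insert (tapps (TFree y) As, tapps a Bs) E; atom a; y \<in> V;
     length xs = length As; distinct xs; \<forall>x \<in> set xs. snd x = Star; i < length xs;
     \<theta> = TFree(y := tlams xs (TFree (xs ! i)))\<rbrakk> \<Longrightarrow>
    match_step R (V, E', \<rho>) (V, bind \<theta> E', tsubst \<theta> \<circ> \<rho>)"
| m_imitate: "\<lbrakk>E' = insert (tapps (TFree y) As, tapps a Bs) E; atom a; y \<in> V;
     length xs = length As; distinct xs; \<forall>x \<in> set xs. snd x = Star;
     length ys = length Bs; distinct ys; set ys \<inter> (R \<union> V) = {};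
     \<forall>z \<in> set ys. snd z = (KFun ^^ length As) Star;
     set xs \<inter> (fv a \<union> set ys) = {};
     \<theta> = TFree(y := tlams xs (tapps a (map (\<lambda>z. tapps (TFree z) (map TFree xs)) ys)))\<rbrakk> \<Longrightarrow>
    match_step R (V, E', \<rho>) (V \<union> set ys, bind \<theta> E', tsubst \<theta> \<circ> \<rho>)"
| m_beta_left: "beta l l' \<Longrightarrow> match_step R (V, insert (l, r) E, \<rho>) (V, insert (l', r) E, \<rho>)"
| m_beta_right: "beta r r' \<Longrightarrow> match_step R (V, insert (l, r) E, \<rho>) (V, insert (l, r') E, \<rho>)"

text \<open>
  \<open>B\<close> matches \<open>A\<close> with \<open>\<sigma>\<close>, where \<open>xs\<close> are the variables to be instantiated. Well-kindedness is
  demanded of the resulting substitution only, up to beta-reduction: with relevant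
  abstractions, \<open>y c d \<mapsto> F c d\<close> has the well-kinded solution \<open>\<lambda>u v. F u v\<close>, but it is reached
  through the projections \<open>\<lambda>u v. u\<close> and \<open>\<lambda>u v. v\<close> for auxiliary variables.
\<close>

definition matches :: "tsym set \<Rightarrow> tsym list \<Rightarrow> ty \<Rightarrow> ty \<Rightarrow> (tsym \<Rightarrow> ty) \<Rightarrow> bool" where
  "matches R xs B A \<sigma> \<longleftrightarrow>
    (\<exists>V \<rho>. (match_step R)\<^sup>*\<^sup>* (set xs, {(B, A)}, TFree) (V, {}, \<rho>) \<and>
       (\<forall>x \<in> set xs. beta\<^sup>*\<^sup>* (\<rho> x) (\<sigma> x) \<and> kinded (\<sigma> x) (Tm (snd x)))) \<and>
    (\<forall>x. x \<notin> set xs \<longrightarrow> \<sigma> x = TFree x)"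

text \<open>
  In \<open>rsm_resolve\<close> and \<open>rsm_forall\<close> the names \<open>xs\<close> are an arbitrary fresh choice of the bound
  variables. All free variables of \<open>\<Gamma>\<close> and of the goal \<open>A\<close> are rigid, which is how
  eigenvariables are treated as constants.
\<close>

inductive rsm :: "(env \<times> ev \<times> ty) set \<Rightarrow> (env \<times> ev \<times> ty) set \<Rightarrow> bool" where
  rsm_resolve: "\<lbrakk>map_of \<Gamma> h = Some (talls xs (timps Ts B)); kinded B (Tm Star); kinded A (Tm Star);
     distinct xs; set xs \<inter> (fvenv \<Gamma> \<union> fv A) = {}; length es = length Ts;
     matches (fvenv \<Gamma> \<union> fv A) xs B A \<sigma>\<rbrakk> \<Longrightarrow>
    rsm (insert (\<Gamma>, apps (Sym h) es, A) \<Phi>)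
        ((\<lambda>(e, T). (\<Gamma>, e, tsubst \<sigma> T)) ` set (zip es Ts) \<union> \<Phi>)"
| rsm_lam: "\<lbrakk>as \<noteq> []; length as = length Ts; kinded A (Tm Star)\<rbrakk> \<Longrightarrow>
    rsm (insert (\<Gamma>, lams as e, timps Ts A) \<Phi>)
        (insert (rev (zip (map EVar as) Ts) @ \<Gamma>, e, A) \<Phi>)"
| rsm_forall: "\<lbrakk>xs \<noteq> []; distinct xs; set xs \<inter> fvenv \<Gamma> = {}\<rbrakk> \<Longrightarrow>
    rsm (insert (\<Gamma>, e, talls xs T) \<Phi>) (insert (\<Gamma>, e, T) \<Phi>)"
| rsm_mu: "rsm (insert (\<Gamma>, Mu a e, T) \<Phi>) (insert ((EVar a, T) # \<Gamma>, e, T) \<Phi>)"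

end

theory Submission
  imports Defs
begin

text \<open>
  Typability of all goals of a state is propagated backwards along a successful run of RSM. In a
  resolution step, composing the bindings made by the matching derivation gives a substitution
  that equates \<open>B\<close> and \<open>A\<close> up to conversion and fixes the rigid variables, hence \<open>A\<close>; so
  instantiating the quantifiers of \<open>h\<close> by \<open>\<sigma>\<close>, applying the result to the evidence for the
  premises and converting gives evidence of \<open>A\<close>. The invariant is that all types are well-kinded,
  which is preserved because \<open>\<sigma>\<close> is a well-kinded substitution.
\<close>

section \<open>Simultaneous substitution for indices and names\<close>

definition upr :: "(nat \<Rightarrow> nat) \<Rightarrow> nat \<Rightarrow> nat" where
  "upr r i = (case i of 0 \<Rightarrow> 0 | Suc j \<Rightarrow> Suc (r j))"

text \<open>Renamings come first because \<open>up\<close> has to shift the types it substitutes.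
  With the shift given by \<open>tren\<close>, \<open>tsub\<close> is primitive recursive.\<close>

primrec tren :: "(nat \<Rightarrow> nat) \<Rightarrow> ty \<Rightarrow> ty" where
  "tren r (TCon F) = TCon F"
| "tren r (TFree x) = TFree x"
| "tren r (TBound i) = TBound (r i)"
| "tren r (TLam T) = TLam (tren (upr r) T)"
| "tren r (TAll K T) = TAll K (tren (upr r) T)"
| "tren r (TApp T U) = TApp (tren r T) (tren r U)"
| "tren r (TImp T U) = TImp (tren r T) (tren r U)"

definition up :: "(nat \<Rightarrow> ty) \<Rightarrow> nat \<Rightarrow> ty" where
  "up b i = (case i of 0 \<Rightarrow> TBound 0 | Suc j \<Rightarrow> tren Suc (b j))"

text \<open>
  The operations \<open>tlift\<close>, \<open>tabs\<close> and \<open>tsubst\<close> and the contraction of a redex are all instances of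
  \<open>tsub\<close>, so each of their commutation laws is a case of the fusion law \<open>tsub_tsub\<close>.
\<close>

primrec tsub :: "(nat \<Rightarrow> ty) \<Rightarrow> (tsym \<Rightarrow> ty) \<Rightarrow> ty \<Rightarrow> ty" where
  "tsub b f (TCon F) = TCon F"
| "tsub b f (TFree x) = f x"
| "tsub b f (TBound i) = b i"
| "tsub b f (TLam T) = TLam (tsub (up b) (\<lambda>x. tren Suc (f x)) T)"
| "tsub b f (TAll K T) = TAll K (tsub (up b) (\<lambda>x. tren Suc (f x)) T)"
| "tsub b f (TApp T U) = TApp (tsub b f T) (tsub b f U)"
| "tsub b f (TImp T U) = TImp (tsub b f T) (tsub b f U)"

text \<open>The substitution that removes an outermost binder: the remaining indices drop by one to
  account for it.\<close>

definition inst :: "ty \<Rightarrow> nat \<Rightarrow> ty" where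
  "inst U i = (case i of 0 \<Rightarrow> U | Suc j \<Rightarrow> TBound j)"

lemma upr_simps [simp]: "upr r 0 = 0" "upr r (Suc i) = Suc (r i)"
  by (simp_all add: upr_def)

lemma up_simps [simp]: "up b 0 = TBound 0" "up b (Suc i) = tren Suc (b i)"
  by (simp_all add: up_def)

lemma inst_simps [simp]: "inst U 0 = U" "inst U (Suc i) = TBound i"
  by (simp_all add: inst_def)

lemma upr_o: "upr r \<circ> upr s = upr (r \<circ> s)"
  by (rule ext) (simp add: upr_def split: nat.split)

lemma tren_tren: "tren r (tren s t) = tren (r \<circ> s) t"
  by (induction t arbitrary: r s) (auto simp: upr_o)

lemma tren_upr_Suc: "tren (upr r) (tren Suc t) = tren Suc (tren r t)"
  by (simp add: tren_tren comp_def)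

lemma up_upr: "up b \<circ> upr r = up (b \<circ> r)"
  by (rule ext) (simp add: upr_def up_def split: nat.split)

lemma tsub_tren: "tsub b f (tren r t) = tsub (b \<circ> r) f t"
  by (induction t arbitrary: b f r) (auto simp: up_upr)

lemma tren_up: "(\<lambda>i. tren (upr r) (up b i)) = up (\<lambda>i. tren r (b i))"
  by (rule ext) (simp add: up_def tren_upr_Suc split: nat.split)

lemma tren_tsub: "tren r (tsub b f t) = tsub (\<lambda>i. tren r (b i)) (\<lambda>x. tren r (f x)) t"
  by (induction t arbitrary: b f r) (auto simp: tren_up tren_upr_Suc)

lemma tsub_up_Suc: "tsub (up b) (\<lambda>x. tren Suc (f x)) (tren Suc t) = tren Suc (tsub b f t)"
  by (simp add: tsub_tren tren_tsub comp_def)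

lemma tsub_up: "(\<lambda>i. tsub (up b) (\<lambda>x. tren Suc (f x)) (up b' i)) = up (\<lambda>i. tsub b f (b' i))"
  by (rule ext) (simp add: up_def tsub_up_Suc split: nat.split)

text \<open>At a binder the lift of a composite has to be the composite of the lifts. That is
  \<open>tsub_up\<close>, which rests on the two mixed laws \<open>tsub_tren\<close> and
  \<open>tren_tsub\<close>.\<close>

lemma tsub_tsub: "tsub b f (tsub b' f' t) = tsub (\<lambda>i. tsub b f (b' i)) (\<lambda>x. tsub b f (f' x)) t"
  by (induction t arbitrary: b f b' f') (auto simp: tsub_up tsub_up_Suc)

lemma tsub_cong:
  assumes "\<And>x. x \<in> fv t \<Longrightarrow> f x = g x"
  shows "tsub b f t = tsub b g t"
  using assms
proof (induction t arbitrary: b f g)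
  case (TLam t)
  show ?case by (simp, rule TLam.IH) (simp add: TLam.prems)
next
  case (TAll K t)
  show ?case by (simp, rule TAll.IH) (simp add: TAll.prems)
next
  case (TApp t u)
  show ?case using TApp.IH [of f g b] TApp.prems by simp
next
  case (TImp t u)
  show ?case using TImp.IH [of f g b] TImp.prems by simp
qed auto

lemma up_TBound: "up TBound = TBound"
  by (rule ext) (simp add: up_def split: nat.split)

lemma tsub_id: "tsub TBound TFree t = t"
  by (induction t) (auto simp: up_TBound)

lemma tlift_tren: "tlift k t = tren (\<lambda>i. if i < k then i else Suc i) t"
proof (induction t arbitrary: k)
  \<comment> \<open>Lifting the shift above \<open>k\<close> gives the shift above
    \<open>Suc k\<close>, just as \<open>tlift\<close> proceeds at a binder.\<close>
  have [simp]: "upr (\<lambda>i. if i < k then i else Suc i) = (\<lambda>i. if i < Suc k then i else Suc i)" for k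
    by (rule ext) (simp add: upr_def split: nat.split)
  { case (TLam t) then show ?case by simp next
    case (TAll K t) then show ?case by simp }
qed auto

lemma tlift_0: "tlift 0 t = tren Suc t"
  by (simp add: tlift_tren)

lemma tsubst_tsub: "tsubst \<sigma> t = tsub TBound \<sigma> t"
  by (induction t arbitrary: \<sigma>) (auto simp: up_TBound tlift_0)

lemma tabs_tsub:
  "tabs k x t = tsub (\<lambda>i. TBound (if i < k then i else Suc i)) (TFree(x := TBound k)) t"
proof (induction t arbitrary: k)
  have [simp]: "up (\<lambda>i. TBound (if i < k then i else Suc i)) =
      (\<lambda>i. TBound (if i < Suc k then i else Suc i))"
    "(\<lambda>y. tren Suc ((TFree(x := TBound k)) y)) = TFree(x := TBound (Suc k))" for k
    by (auto simp: up_def fun_eq_iff split: nat.split)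
  { case (TLam t) then show ?case by (simp del: fun_upd_apply) next
    case (TAll K t) then show ?case by (simp del: fun_upd_apply) }
qed auto

lemma tabs_0: "tabs 0 x t = tsub (\<lambda>i. TBound (Suc i)) (TFree(x := TBound 0)) t"
  by (simp add: tabs_tsub)

lemma inst_tabs: "tsub (inst U) TFree (tabs 0 x t) = tsubst (TFree(x := U)) t"
proof -
  have "(\<lambda>y. tsub (inst U) TFree ((TFree(x := TBound 0)) y)) = TFree(x := U)" by auto
  then show ?thesis by (simp add: tabs_0 tsub_tsub tsubst_tsub)
qed

text \<open>Freshness of \<open>x\<close> ensures that closing captures only the occurrences created
  by opening. Hence every body of a binder is the abstraction of a named type.\<close>

lemma tabs_inst:
  assumes "x \<notin> fv t"
  shows "tabs 0 x (tsub (inst (TFree x)) TFree t) = t"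
proof -
  have "tabs 0 x (tsub (inst (TFree x)) TFree t) =
      tsub (\<lambda>i. tabs 0 x (inst (TFree x) i)) (\<lambda>y. tabs 0 x (TFree y)) t"
    by (simp add: tabs_tsub tsub_tsub)
  also have "(\<lambda>i. tabs 0 x (inst (TFree x) i)) = TBound"
    by (rule ext) (simp add: inst_def split: nat.split)
  also have "tsub TBound (\<lambda>y. tabs 0 x (TFree y)) t = tsub TBound TFree t"
    using assms by (intro tsub_cong) auto
  finally show ?thesis by (simp add: tsub_id)
qed

lemma finite_fv [simp]: "finite (fv t)"
  by (induction t) auto

lemma ex_fresh_tsym:
  assumes "finite (A :: tsym set)"
  obtains x where "x \<notin> A" "snd x = K"
proof -
  \<comment> \<open>Freshness is achieved by the string alone, so the kind can be
    prescribed.\<close>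
  have "\<exists>s. s \<notin> fst ` A"
    using assms by (intro ex_new_if_finite infinite_UNIV_listI finite_imageI)
  then obtain s where "s \<notin> fst ` A" by blast
  then have "(s, K) \<notin> A" by force
  with that show thesis by (metis snd_conv)
qed

lemma tsubst_tsubst: "tsubst \<theta> (tsubst \<rho> t) = tsubst (tsubst \<theta> \<circ> \<rho>) t"
  by (simp add: tsubst_tsub tsub_tsub comp_def)

lemma tsubst_cong: "(\<And>x. x \<in> fv t \<Longrightarrow> f x = g x) \<Longrightarrow> tsubst f t = tsubst g t"
  unfolding tsubst_tsub by (rule tsub_cong)

lemma tsubst_TFree: "tsubst TFree t = t"
  by (simp add: tsubst_tsub tsub_id)

lemma tsubst_tapps: "tsubst \<theta> (tapps a As) = tapps (tsubst \<theta> a) (map (tsubst \<theta>) As)"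
  unfolding tapps_def by (induction As arbitrary: a) auto

lemma tsubst_timps: "tsubst \<theta> (timps Ts A) = timps (map (tsubst \<theta>) Ts) (tsubst \<theta> A)"
  unfolding timps_def by (induction Ts) auto

lemma fv_tren [simp]: "fv (tren r t) = fv t"
  by (induction t arbitrary: r) auto

lemma fv_tsubst: "fv (tsubst \<theta> t) = (\<Union>x \<in> fv t. fv (\<theta> x))"
  by (induction t arbitrary: \<theta>) (auto simp: tlift_0)

lemma fv_tabs [simp]: "fv (tabs k x t) = fv t - {x}"
  by (induction t arbitrary: k) auto

lemma fv_talls: "fv (talls xs t) = fv t - set xs"
  unfolding talls_def tall_def by (induction xs) auto

lemma fv_timps: "fv (timps Ts A) = (\<Union>T \<in> set Ts. fv T) \<union> fv A"
  unfolding timps_def by (induction Ts) auto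

text \<open>Substitution under a named binder, with the bound name changed from \<open>x\<close> to
  \<open>x'\<close>. As \<open>x'\<close> does not occur in the substituted types, abstracting it
  only shifts them.\<close>

lemma tsubst_tabs:
  assumes "\<And>y. y \<in> fv t \<Longrightarrow> y \<noteq> x \<Longrightarrow> x' \<notin> fv (\<theta> y)"
  shows "tsubst (\<lambda>y. tlift 0 (\<theta> y)) (tabs 0 x t) = tabs 0 x' (tsubst (\<theta>(x := TFree x')) t)"
proof -
  have lift: "tsub (\<lambda>i. TBound (Suc i)) (TFree(x' := TBound 0)) u = tren Suc u" if "x' \<notin> fv u" for u
  proof -
    have "tsub (\<lambda>i. TBound (Suc i)) (TFree(x' := TBound 0)) u = tsub (TBound \<circ> Suc) TFree u"
      using that by (auto simp: comp_def intro: tsub_cong)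
    then show ?thesis by (simp flip: tsub_tren add: tsub_id)
  qed
  show ?thesis
    unfolding tsubst_tsub tabs_0 tsub_tsub
    using assms by (auto simp: tlift_0 lift intro: tsub_cong)
qed

section \<open>Conversion\<close>

text \<open>The rules of \<open>beta\<close> speak of a named bound variable. This version works on
  indices directly, so that stability under substitution is a plain rule induction.\<close>

inductive dbeta :: "ty \<Rightarrow> ty \<Rightarrow> bool" where
  "dbeta (TApp (TLam t) u) (tsub (inst u) TFree t)"
| "dbeta t t' \<Longrightarrow> dbeta (TLam t) (TLam t')"
| "dbeta t t' \<Longrightarrow> dbeta (TAll K t) (TAll K t')"
| "dbeta t t' \<Longrightarrow> dbeta (TApp t u) (TApp t' u)"
| "dbeta u u' \<Longrightarrow> dbeta (TApp t u) (TApp t u')"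
| "dbeta t t' \<Longrightarrow> dbeta (TImp t u) (TImp t' u)"
| "dbeta u u' \<Longrightarrow> dbeta (TImp t u) (TImp t u')"

lemma dbeta_tsub: "dbeta t t' \<Longrightarrow> dbeta (tsub b f t) (tsub b f t')"
proof (induction arbitrary: b f rule: dbeta.induct)
  case (1 t u)
  \<comment> \<open>At index 0 both sides are the substituted argument. At a successor the shift
    made by \<open>up\<close> cancels against the contraction.\<close>
  have "(\<lambda>i. tsub b f (inst u i)) = (\<lambda>i. tsub (inst (tsub b f u)) TFree (up b i))"
    by (rule ext) (simp add: inst_def up_def tsub_tren comp_def tsub_id split: nat.split)
  then have "tsub b f (tsub (inst u) TFree t) =
      tsub (inst (tsub b f u)) TFree (tsub (up b) (\<lambda>x. tren Suc (f x)) t)"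
    by (simp add: tsub_tsub tsub_tren comp_def tsub_id)
  then show ?case by (simp add: dbeta.intros)
qed (auto intro: dbeta.intros)

lemma beta_imp_dbeta: "beta t t' \<Longrightarrow> dbeta t t'"
proof (induction rule: beta.induct)
  case (1 x T U)
  then show ?case by (metis tlam_def inst_tabs dbeta.intros(1))
qed (auto simp: tlam_def tall_def tabs_tsub intro: dbeta.intros dbeta_tsub)

lemma size_tren [simp]: "size (tren r t) = size t"
  by (induction t arbitrary: r) auto

text \<open>Indices and names have size 0. Thus opening a binder with a name keeps
  \<open>size\<close>, which is the measure for \<open>dbeta_imp_beta\<close>.\<close>

lemma size_tsub:
  "(\<And>i. size (b i) = 0) \<Longrightarrow> (\<And>x. size (f x) = 0) \<Longrightarrow> size (tsub b f t) = size t"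
proof (induction t arbitrary: b f)
  have [simp]: "size (up b i) = 0" if "\<And>i. size (b i) = 0" for b i
    using that by (simp add: up_def split: nat.split)
  { case (TLam t) then show ?case by simp next
    case (TAll K t) then show ?case by simp }
qed auto

lemma size_inst_TFree [simp]: "size (tsub (inst (TFree x)) TFree t) = size t"
  by (rule size_tsub) (auto simp: inst_def split: nat.split)

text \<open>To get a named bound variable, the bodies on both sides are opened with a common fresh
  name. Opened bodies are not covered by a rule induction, but they are smaller than
  \<open>t\<close>, and \<open>dbeta_tsub\<close> carries the reduction over to them.\<close>

lemma dbeta_imp_beta: "dbeta t t' \<Longrightarrow> beta t t'"
proof (induction "size t" arbitrary: t t' rule: less_induct)
  case less
  have body: "\<exists>x u u'. snd x = K \<and> s = tabs 0 x u \<and> s' = tabs 0 x u' \<and> beta u u'"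
    if "dbeta s s'" "size s < size t" for s s' K
  proof -
    obtain x where x: "x \<notin> fv s \<union> fv s'" "snd x = K"
      using ex_fresh_tsym [of "fv s \<union> fv s'" K] by auto
    have "beta (tsub (inst (TFree x)) TFree s) (tsub (inst (TFree x)) TFree s')"
      using that by (intro less.hyps dbeta_tsub) auto
    with x show ?thesis
      by (metis tabs_inst UnCI)
  qed
  from less.prems show ?case
  proof cases
    case (1 s u)
    obtain x where "x \<notin> fv s" using ex_fresh_tsym [OF finite_fv] by metis
    then show ?thesis
      using beta.intros(1) [of x "tsub (inst (TFree x)) TFree s" u] 1
      by (metis tabs_inst inst_tabs tlam_def)
  next
    case (2 s s')
    \<comment> \<open>Any kind would do here, since \<open>TLam\<close> records none.\<close>
    then obtain x u u' where "s = tabs 0 x u" "s' = tabs 0 x u'" "beta u u'"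
      using body [of s s' Star] by auto
    then show ?thesis using beta.intros(2) [of u u' x] 2 by (simp add: tlam_def)
  next
    case (3 s s' K)
    then obtain x u u' where "snd x = K" "s = tabs 0 x u" "s' = tabs 0 x u'" "beta u u'"
      using body [of s s' K] by auto
    then show ?thesis using beta.intros(3) [of u u' x] 3 by (simp add: tall_def)
  qed (use less.hyps in \<open>auto intro: beta.intros\<close>)
qed

lemma beta_eq_dbeta: "beta = dbeta"
  by (intro ext) (metis beta_imp_dbeta dbeta_imp_beta)

lemma equivclp_map:
  assumes "\<And>x y. r x y \<Longrightarrow> s (f x) (f y)" "equivclp r x y"
  shows "equivclp s (f x) (f y)"
  using assms(2)
proof (induction rule: equivclp_induct)
  case base
  show ?case by (rule equivclp_refl)
next
  case (step y z)
  then show ?case using assms(1) by (meson equivclp_trans r_into_equivclp equivclp_sym)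
qed

lemma equivclp_beta_TApp:
  assumes "equivclp beta t t'" "equivclp beta u u'"
  shows "equivclp beta (TApp t u) (TApp t' u')"
  using equivclp_map [of beta beta "\<lambda>t. TApp t u", OF beta.intros(4) assms(1)]
    equivclp_map [of beta beta "TApp t'", OF beta.intros(5) assms(2)]
  by (rule equivclp_trans)

lemma equivclp_beta_TImp:
  assumes "equivclp beta t t'" "equivclp beta u u'"
  shows "equivclp beta (TImp t u) (TImp t' u')"
  using equivclp_map [of beta beta "\<lambda>t. TImp t u", OF beta.intros(6) assms(1)]
    equivclp_map [of beta beta "TImp t'", OF beta.intros(7) assms(2)]
  by (rule equivclp_trans)

lemma equivclp_beta_tsubst: "beta t t' \<Longrightarrow> equivclp beta (tsubst \<theta> t) (tsubst \<theta> t')"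
  by (simp add: r_into_equivclp beta_eq_dbeta tsubst_tsub dbeta_tsub)

lemma equivclp_beta_tlift: "equivclp beta t t' \<Longrightarrow> equivclp beta (tlift 0 t) (tlift 0 t')"
proof (erule equivclp_map [rotated])
  have "tlift 0 t = tsub (TBound \<circ> Suc) TFree t" for t
    by (simp flip: tsub_tren add: tsub_id tlift_0)
  then show "beta t t' \<Longrightarrow> beta (tlift 0 t) (tlift 0 t')" for t t'
    by (simp add: beta_eq_dbeta dbeta_tsub)
qed

text \<open>Needed because \<open>matches\<close> determines \<open>\<sigma>\<close> only up to
  reduction of the substitution computed by the run.\<close>

lemma equivclp_beta_tsubst_cong:
  "(\<And>x. x \<in> fv t \<Longrightarrow> equivclp beta (\<theta> x) (\<theta>' x)) \<Longrightarrow> equivclp beta (tsubst \<theta> t) (tsubst \<theta>' t)"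
proof (induction t arbitrary: \<theta> \<theta>')
  case (TLam t)
  then have "equivclp beta (tsubst (\<lambda>x. tlift 0 (\<theta> x)) t) (tsubst (\<lambda>x. tlift 0 (\<theta>' x)) t)"
    by (simp add: equivclp_beta_tlift)
  then show ?case
    by (auto simp: beta_eq_dbeta intro: equivclp_map dbeta.intros)
next
  case (TAll K t)
  then have "equivclp beta (tsubst (\<lambda>x. tlift 0 (\<theta> x)) t) (tsubst (\<lambda>x. tlift 0 (\<theta>' x)) t)"
    by (simp add: equivclp_beta_tlift)
  then show ?case
    by (auto simp: beta_eq_dbeta intro: equivclp_map dbeta.intros)
qed (auto intro: equivclp_beta_TApp equivclp_beta_TImp)

lemma equivclp_beta_tapps:
  assumes "list_all2 (equivclp beta) As Bs" "equivclp beta a b"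
  shows "equivclp beta (tapps a As) (tapps b Bs)"
  using assms unfolding tapps_def
  by (induction arbitrary: a b rule: list_all2_induct) (auto intro: equivclp_beta_TApp)

section \<open>Matching\<close>

text \<open>Induction from the end of the run, where \<open>TFree\<close> unifies the empty set of
  problems. Only variables in \<open>V\<close> are ever bound, and imitation adds only names outside
  \<open>R\<close>, so \<open>R\<close> and \<open>V\<close> stay disjoint and rigid variables stay
  fixed.\<close>

lemma match_steps_unifier:
  assumes "(match_step R)\<^sup>*\<^sup>* (V, E, \<rho>) (V', {}, \<rho>')" "R \<inter> V = {}"
  shows "\<exists>\<tau>. \<rho>' = tsubst \<tau> \<circ> \<rho> \<and> (\<forall>x \<in> R. \<tau> x = TFree x) \<and>
    (\<forall>(l, r) \<in> E. equivclp beta (tsubst \<tau> l) (tsubst \<tau> r))"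
  using assms
proof (induction "(V, E, \<rho>)" arbitrary: V E \<rho> rule: converse_rtranclp_induct)
  case base
  show ?case by (rule exI [of _ TFree]) (auto simp: tsubst_TFree)
next
  case (step s)
  \<comment> \<open>Projection and imitation are treated alike: whatever \<open>t\<close> is, a
    unifier of the instantiated problems composed with \<open>\<theta>\<close> unifies the original
    ones.\<close>
  have bind: ?case
    if s: "s = (W, bind \<theta> E, tsubst \<theta> \<circ> \<rho>)" "R \<inter> W = {}" "\<theta> = TFree(y := t)" "y \<in> V" for W \<theta> y t
  proof -
    obtain \<tau> where \<tau>: "\<rho>' = tsubst \<tau> \<circ> (tsubst \<theta> \<circ> \<rho>)" "\<forall>x \<in> R. \<tau> x = TFree x"
      "\<forall>(l, r) \<in> bind \<theta> E. equivclp beta (tsubst \<tau> l) (tsubst \<tau> r)"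
      using step.hyps(3) [OF s(1,2)] by blast
    from \<tau>(3) have "\<forall>(l, r) \<in> E. equivclp beta (tsubst (tsubst \<tau> \<circ> \<theta>) l) (tsubst (tsubst \<tau> \<circ> \<theta>) r)"
      by (auto simp: bind_def tsubst_tsubst)
    moreover have "(tsubst \<tau> \<circ> \<theta>) x = TFree x" if "x \<in> R" for x
      using that s(3,4) step.prems \<tau>(2) by auto
    moreover have "\<rho>' = tsubst (tsubst \<tau> \<circ> \<theta>) \<circ> \<rho>"
      using \<tau>(1) by (simp add: fun_eq_iff tsubst_tsubst)
    ultimately show ?thesis by blast
  qed
  from step.hyps(1) show ?case
  proof cases
    case (m_decompose a As Bs E0)
    obtain \<tau> where \<tau>: "\<rho>' = tsubst \<tau> \<circ> \<rho>" "\<forall>x \<in> R. \<tau> x = TFree x"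
      "\<forall>(l, r) \<in> set (zip As Bs) \<union> E0. equivclp beta (tsubst \<tau> l) (tsubst \<tau> r)"
      using step.hyps(3) [OF m_decompose(2) step.prems] by blast
    have "list_all2 (equivclp beta) (map (tsubst \<tau>) As) (map (tsubst \<tau>) Bs)"
      using \<tau>(3) m_decompose by (auto simp: list_all2_iff zip_map_map)
    then have "equivclp beta (tsubst \<tau> (tapps a As)) (tsubst \<tau> (tapps a Bs))"
      by (simp add: tsubst_tapps equivclp_beta_tapps)
    with \<tau> m_decompose show ?thesis by (intro exI [of _ \<tau>]) auto
  next
    case (m_proj y As a Bs E0 xs i \<theta>)
    then show ?thesis using bind step.prems by blast
  next
    case (m_imitate y As a Bs E0 xs ys \<theta>)
    moreover have "R \<inter> (V \<union> set ys) = {}" using m_imitate step.prems by blast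
    ultimately show ?thesis using bind by blast
  next
    case (m_beta_left l l' r E0)
    obtain \<tau> where \<tau>: "\<rho>' = tsubst \<tau> \<circ> \<rho>" "\<forall>x \<in> R. \<tau> x = TFree x"
      "\<forall>(l, r) \<in> insert (l', r) E0. equivclp beta (tsubst \<tau> l) (tsubst \<tau> r)"
      using step.hyps(3) [OF m_beta_left(2) step.prems] by blast
    moreover from this(3) have "equivclp beta (tsubst \<tau> l) (tsubst \<tau> r)"
      using equivclp_beta_tsubst [OF m_beta_left(3), of \<tau>] by (auto intro: equivclp_trans)
    ultimately show ?thesis using m_beta_left by (intro exI [of _ \<tau>]) auto
  next
    case (m_beta_right r r' l E0)
    obtain \<tau> where \<tau>: "\<rho>' = tsubst \<tau> \<circ> \<rho>" "\<forall>x \<in> R. \<tau> x = TFree x"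
      "\<forall>(l, r) \<in> insert (l, r') E0. equivclp beta (tsubst \<tau> l) (tsubst \<tau> r)"
      using step.hyps(3) [OF m_beta_right(2) step.prems] by blast
    moreover from this(3) have "equivclp beta (tsubst \<tau> l) (tsubst \<tau> r)"
      using equivclp_beta_tsubst [OF m_beta_right(3), of \<tau>]
      by (auto intro: equivclp_trans equivclp_sym)
    ultimately show ?thesis using m_beta_right by (intro exI [of _ \<tau>]) auto
  qed
qed

lemma rtranclp_imp_equivclp: "r\<^sup>*\<^sup>* x y \<Longrightarrow> equivclp r x y"
  by (induction rule: rtranclp_induct) (auto intro: equivclp_trans r_into_equivclp)

text \<open>All names of \<open>A\<close> are rigid, so the unifier leaves \<open>A\<close> alone.
  On \<open>B\<close> it is convertible with \<open>\<sigma>\<close>: by reduction on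
  \<open>xs\<close>, and because both are the identity on rigid names.\<close>

lemma matches_sound:
  assumes m: "matches R xs B A \<sigma>" and "set xs \<inter> R = {}" "fv A \<subseteq> R" "fv B \<subseteq> R \<union> set xs"
  shows "equivclp beta (tsubst \<sigma> B) A" "\<And>x. kinded (\<sigma> x) (Tm (snd x))"
proof -
  from m obtain V \<rho> where
    steps: "(match_step R)\<^sup>*\<^sup>* (set xs, {(B, A)}, TFree) (V, {}, \<rho>)"
    and \<sigma>: "\<And>x. x \<in> set xs \<Longrightarrow> beta\<^sup>*\<^sup>* (\<rho> x) (\<sigma> x) \<and> kinded (\<sigma> x) (Tm (snd x))"
      "\<And>x. x \<notin> set xs \<Longrightarrow> \<sigma> x = TFree x"
    unfolding matches_def by blast
  have "R \<inter> set xs = {}" using assms by blast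
  from match_steps_unifier [OF steps this] obtain \<tau> where
    \<tau>: "\<rho> = tsubst \<tau> \<circ> TFree" "\<forall>x \<in> R. \<tau> x = TFree x" "equivclp beta (tsubst \<tau> B) (tsubst \<tau> A)"
    by auto
  \<comment> \<open>The run starts from the identity, so its accumulated substitution is the unifier
    itself.\<close>
  have [simp]: "\<rho> = \<tau>" using \<tau>(1) by (simp add: fun_eq_iff)
  have "tsubst \<tau> A = A"
    using tsubst_cong [of A \<tau> TFree] \<tau>(2) assms by (auto simp: tsubst_TFree)
  moreover have "equivclp beta (\<sigma> x) (\<tau> x)" if "x \<in> fv B" for x
  proof (cases "x \<in> set xs")
    case True
    then show ?thesis using \<sigma>(1) [OF True] by (auto intro: rtranclp_imp_equivclp equivclp_sym)
  next
    case False
    then show ?thesis using \<sigma>(2) \<tau>(2) that assms by auto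
  qed
  then have "equivclp beta (tsubst \<sigma> B) (tsubst \<tau> B)"
    by (rule equivclp_beta_tsubst_cong)
  ultimately show "equivclp beta (tsubst \<sigma> B) A"
    using \<tau>(3) by (auto intro: equivclp_trans)
  show "kinded (\<sigma> x) (Tm (snd x))" for x
    using \<sigma> kinded.intros(2) by (cases "x \<in> set xs") auto
qed

section \<open>Kinding\<close>

lemma kinded_tsubst:
  "kinded t k \<Longrightarrow> (\<And>x. kinded (\<theta> x) (Tm (snd x))) \<Longrightarrow> kinded (tsubst \<theta> t) k"
proof (induction arbitrary: \<theta> rule: kinded.induct)
  case (3 t K x)
  obtain x' where x': "x' \<notin> (\<Union>y \<in> fv t. fv (\<theta> y))" "snd x' = snd x"
    using ex_fresh_tsym [of "\<Union>y \<in> fv t. fv (\<theta> y)" "snd x"] by auto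
  have "kinded (tsubst (\<theta>(x := TFree x')) t) (Tm K)"
    using 3 x' kinded.intros(2) [of x'] by auto
  \<comment> \<open>The abstraction remains relevant: \<open>x\<close> occurs in \<open>t\<close>
    and is sent to \<open>x'\<close>.\<close>
  moreover have "x' \<in> fv (tsubst (\<theta>(x := TFree x')) t)"
    using 3 by (auto simp: fv_tsubst)
  ultimately have "kinded (tlam x' (tsubst (\<theta>(x := TFree x')) t)) (Tm (KFun K))"
    using 3 x' by (simp add: kinded.intros)
  moreover have "tsubst \<theta> (tlam x t) = tlam x' (tsubst (\<theta>(x := TFree x')) t)"
    using x' by (auto simp: tlam_def intro: tsubst_tabs)
  ultimately show ?case by simp
next
  case (5 t k x)
  obtain x' where x': "x' \<notin> (\<Union>y \<in> fv t. fv (\<theta> y))" "snd x' = snd x"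
    using ex_fresh_tsym [of "\<Union>y \<in> fv t. fv (\<theta> y)" "snd x"] by auto
  have "kinded (tsubst (\<theta>(x := TFree x')) t) k"
    using 5 x' kinded.intros(2) [of x'] by auto
  then have "kinded (tall x' (tsubst (\<theta>(x := TFree x')) t)) Omicron"
    using 5 by (blast intro: kinded.intros)
  moreover have "tsubst \<theta> (tall x t) = tall x' (tsubst (\<theta>(x := TFree x')) t)"
    using x' by (auto simp: tall_def intro: tsubst_tabs)
  ultimately show ?case by simp
qed (auto intro: kinded.intros)

lemma well_kinded_tsubst:
  "well_kinded t \<Longrightarrow> (\<And>x. kinded (\<theta> x) (Tm (snd x))) \<Longrightarrow> well_kinded (tsubst \<theta> t)"
  unfolding well_kinded_def using kinded_tsubst by blast

text \<open>Inverting the kinding rule yields a body with some other bound name \<open>x'\<close>.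
  Renaming \<open>x'\<close> to \<open>x\<close>, which has the same kind, recovers \<open>t\<close>
  and keeps its kind.\<close>

lemma well_kinded_tall:
  assumes "well_kinded (tall x t)"
  shows "well_kinded t"
proof -
  from assms obtain k where "kinded (tall x t) k" unfolding well_kinded_def by blast
  then obtain x' t' k' where t': "snd x = snd x'" "tabs 0 x t = tabs 0 x' t'"
    "kinded t' k'" "k' \<in> {Omicron, Tm Star}"
    by cases (auto simp: tall_def tlam_def)
  have "t = tsub (inst (TFree x)) TFree (tabs 0 x t)"
    by (simp add: inst_tabs tsubst_TFree)
  also have "\<dots> = tsubst (TFree(x' := TFree x)) t'"
    by (simp add: inst_tabs t')
  finally have "kinded t k'"
    using kinded_tsubst [OF t'(3), of "TFree(x' := TFree x)"] t'(1) kinded.intros(2)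
    by (metis fun_upd_apply)
  with t'(4) show ?thesis by (auto simp: well_kinded_def)
qed

lemma well_kinded_talls: "well_kinded (talls xs t) \<Longrightarrow> well_kinded t"
  unfolding talls_def by (induction xs) (auto dest: well_kinded_tall)

lemma well_kinded_TImp: "well_kinded (TImp t u) \<Longrightarrow> well_kinded t \<and> well_kinded u"
  unfolding well_kinded_def by (auto elim: kinded.cases simp: tlam_def tall_def)

lemma well_kinded_timps:
  "well_kinded (timps Ts A) \<Longrightarrow> (\<forall>T \<in> set Ts. well_kinded T) \<and> well_kinded A"
  unfolding timps_def by (induction Ts) (auto dest: well_kinded_TImp)

section \<open>Typability of Curry-style evidence\<close>

definition typable :: "env \<Rightarrow> ev \<Rightarrow> ty \<Rightarrow> bool" where
  "typable \<Gamma> e T \<longleftrightarrow> (\<exists>e'. typing \<Gamma> e' T \<and> erase e' = e)"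

text \<open>The rule \<open>t_inst\<close> wants a named quantifier; a fresh name of kind
  \<open>K\<close> provides one. The added \<open>Inst\<close> vanishes under erasure.\<close>

lemma typable_TAll:
  assumes "typable \<Gamma> e (TAll K t)" "kinded U (Tm K)"
  shows "typable \<Gamma> e (tsub (inst U) TFree t)"
proof -
  obtain x where x: "x \<notin> fv t" "snd x = K" using ex_fresh_tsym [of "fv t"] by auto
  then have "TAll K t = tall x (tsub (inst (TFree x)) TFree t)"
    by (simp add: tall_def tabs_inst)
  moreover have "tsub (inst U) TFree t = tsubst (TFree(x := U)) (tsub (inst (TFree x)) TFree t)"
    using x by (metis inst_tabs tabs_inst)
  ultimately show ?thesis
    using assms x t_inst unfolding typable_def by (metis erase.simps(5))
qed

text \<open>
  The substitution \<open>\<theta>\<close> records the quantifiers already instantiated; since each stage is again a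
  single simultaneous substitution, values of \<open>\<sigma>\<close> that mention \<open>xs\<close> do no harm.
\<close>

lemma typable_tsubst_talls:
  "typable \<Gamma> e (tsubst \<theta> (talls xs t)) \<Longrightarrow> (\<And>x. kinded (\<sigma> x) (Tm (snd x))) \<Longrightarrow>
    (\<And>x. x \<notin> set xs \<Longrightarrow> \<sigma> x = \<theta> x) \<Longrightarrow> typable \<Gamma> e (tsubst \<sigma> t)"
proof (induction xs arbitrary: \<theta>)
  case Nil
  then have "\<sigma> = \<theta>" by auto
  with Nil show ?case by (simp add: talls_def)
next
  case (Cons x xs)
  define s where "s = tabs 0 x (talls xs t)"
  have "typable \<Gamma> e (TAll (snd x) (tsubst (\<lambda>y. tlift 0 (\<theta> y)) s))"
    using Cons.prems(1) by (simp add: talls_def tall_def s_def)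
  then have "typable \<Gamma> e (tsub (inst (\<sigma> x)) TFree (tsubst (\<lambda>y. tlift 0 (\<theta> y)) s))"
    by (rule typable_TAll) (rule Cons.prems)
  \<comment> \<open>The shift of \<open>\<theta>\<close> under the quantifier cancels against
    \<open>inst\<close>, and index 0, which stands for \<open>x\<close>, receives
    \<open>\<sigma> x\<close>.\<close>
  also have "tsub (inst (\<sigma> x)) TFree (tsubst (\<lambda>y. tlift 0 (\<theta> y)) s)
      = tsubst (\<theta>(x := \<sigma> x)) (talls xs t)"
    unfolding s_def tabs_0 tsubst_tsub tsub_tsub
    by (auto simp: tlift_0 tsub_tren comp_def tsub_id intro: tsub_cong)
  finally have "typable \<Gamma> e (tsubst (\<theta>(x := \<sigma> x)) (talls xs t))" .
  then show ?case
    by (rule Cons.IH) (use Cons.prems in auto)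
qed

lemma typable_apps:
  assumes "length es = length Ts" "typable \<Gamma> e (timps Ts A)"
    "\<And>e T. (e, T) \<in> set (zip es Ts) \<Longrightarrow> typable \<Gamma> e T"
  shows "typable \<Gamma> (apps e es) A"
  using assms
proof (induction es Ts arbitrary: e rule: list_induct2)
  case Nil
  then show ?case by (simp add: apps_def timps_def)
next
  case (Cons e1 es T Ts)
  have "typable \<Gamma> e1 T" "typable \<Gamma> e (TImp T (timps Ts A))"
    using Cons.prems by (auto simp: timps_def)
  then have "typable \<Gamma> (App e e1) (timps Ts A)"
    unfolding typable_def using t_app by (metis erase.simps(3))
  with Cons show ?case by (simp add: apps_def)
qed

text \<open>The outermost abstraction is declared first and so lies deepest in the reversed list,
  next to \<open>\<Gamma>\<close>. The induction therefore has to vary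
  \<open>\<Gamma>\<close>.\<close>

lemma typable_lams:
  assumes "length as = length Ts" "\<forall>T \<in> set Ts. well_kinded T"
    "typable (rev (zip (map EVar as) Ts) @ \<Gamma>) e A"
  shows "typable \<Gamma> (lams as e) (timps Ts A)"
  using assms
proof (induction as Ts arbitrary: \<Gamma> rule: list_induct2)
  case Nil
  then show ?case by (simp add: lams_def timps_def)
next
  case (Cons a as T Ts)
  then have "typable ((EVar a, T) # \<Gamma>) (lams as e) (timps Ts A)" by simp
  then obtain e' where e': "typing ((EVar a, T) # \<Gamma>) e' (timps Ts A)" "erase e' = lams as e"
    unfolding typable_def by blast
  then have "typing \<Gamma> (Lam a e') (timps (T # Ts) A)"
    using Cons.prems(1) by (simp add: timps_def t_lam)
  with e'(2) show ?case
    unfolding typable_def by (auto simp: lams_def intro: exI [of _ "Lam a e'"])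
qed

lemma typable_talls:
  assumes "typable \<Gamma> e T" "set xs \<inter> fvenv \<Gamma> = {}"
  shows "typable \<Gamma> e (talls xs T)"
  using assms
proof (induction xs)
  case Nil
  then show ?case by (simp add: talls_def)
next
  case (Cons x xs)
  then have "typable \<Gamma> e (talls xs T)" "x \<notin> fvenv \<Gamma>" by auto
  then show ?case
    unfolding typable_def talls_def foldr.simps comp_apply using t_abs by (metis erase.simps(6))
qed

text \<open>Every name in the head is either quantified or rigid, as \<open>matches_sound\<close>
  requires.\<close>

lemma fv_declared_head:
  assumes "map_of \<Gamma> h = Some (talls xs (timps Ts B))"
  shows "fv B \<subseteq> fvenv \<Gamma> \<union> set xs"
proof -
  have "fv (talls xs (timps Ts B)) \<subseteq> fvenv \<Gamma>"
    using map_of_SomeD [OF assms] by (auto simp: fvenv_def)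
  then show ?thesis by (auto simp: fv_talls fv_timps)
qed

lemma typable_resolve:
  assumes h: "map_of \<Gamma> h = Some (talls xs (timps Ts B))" and A: "kinded A (Tm Star)"
    and fresh: "set xs \<inter> (fvenv \<Gamma> \<union> fv A) = {}" and len: "length es = length Ts"
    and m: "matches (fvenv \<Gamma> \<union> fv A) xs B A \<sigma>"
    and es: "\<And>e T. (e, T) \<in> set (zip es Ts) \<Longrightarrow> typable \<Gamma> e (tsubst \<sigma> T)"
  shows "typable \<Gamma> (apps (Sym h) es) A"
proof -
  have "fv B \<subseteq> fvenv \<Gamma> \<union> fv A \<union> set xs"
    using fv_declared_head [OF h] by blast
  note sound = matches_sound [OF m fresh Un_upper2 this]
  \<comment> \<open>The declared type is written as an identity instance, from which the successive
    instantiation by \<open>\<sigma>\<close> starts.\<close>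
  have "typable \<Gamma> (Sym h) (tsubst TFree (talls xs (timps Ts B)))"
    unfolding typable_def tsubst_TFree using t_sym [OF h] by (metis erase.simps(1))
  moreover note sound(2)
  moreover have "\<sigma> x = TFree x" if "x \<notin> set xs" for x
    using m that unfolding matches_def by blast
  ultimately have "typable \<Gamma> (Sym h) (tsubst \<sigma> (timps Ts B))"
    by (rule typable_tsubst_talls)
  then have "typable \<Gamma> (apps (Sym h) es) (tsubst \<sigma> B)"
    using len es by (intro typable_apps [where Ts = "map (tsubst \<sigma>) Ts"])
      (auto simp: tsubst_timps zip_map2)
  then obtain e' where e': "typing \<Gamma> e' (tsubst \<sigma> B)" "erase e' = apps (Sym h) es"
    unfolding typable_def by blast
  have "typing \<Gamma> e' A"
    using A by (intro t_conv [OF e'(1) sound(1)]) (simp add: well_kinded_def)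
  with e'(2) show ?thesis unfolding typable_def by blast
qed

definition well_kinded_goal :: "env \<times> ev \<times> ty \<Rightarrow> bool" where
  "well_kinded_goal = (\<lambda>(\<Gamma>, e, T). (\<forall>(h, S) \<in> set \<Gamma>. well_kinded S) \<and> well_kinded T)"

lemma rsm_sound:
  assumes "rsm\<^sup>*\<^sup>* \<Phi> {}" "(\<Gamma>, e, T) \<in> \<Phi>" "well_kinded_goal (\<Gamma>, e, T)"
  shows "typable \<Gamma> e T"
  using assms
proof (induction arbitrary: \<Gamma> e T rule: converse_rtranclp_induct)
  case base
  then show ?case by simp
next
  case (step \<Phi> \<Phi>')
  note IH = step.IH [unfolded well_kinded_goal_def prod.case]
    and wk = step.prems(2) [unfolded well_kinded_goal_def prod.case]
  show ?case
  \<comment> \<open>States are sets, so a step may leave the goal in place, and then the induction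
    hypothesis applies to it directly. Otherwise the goal is the one that the step rewrote, which
    identifies it in each rule.\<close>
  proof (cases "(\<Gamma>, e, T) \<in> \<Phi>'")
    case True
    then show ?thesis using step.IH step.prems by blast
  next
    case False
    from step.hyps(1) show ?thesis
    proof cases
      case (rsm_resolve \<Delta> h xs Ts B A es \<sigma> \<Phi>0)
      have eq: "\<Delta> = \<Gamma>" "e = apps (Sym h) es" "A = T" using step.prems(1) False rsm_resolve(1,2) by auto
      have "well_kinded (talls xs (timps Ts B))"
        using map_of_SomeD [OF rsm_resolve(3)] wk eq by blast
      then have Ts: "\<forall>S \<in> set Ts. well_kinded S"
        using well_kinded_talls well_kinded_timps by blast
      have "fv B \<subseteq> fvenv \<Delta> \<union> fv A \<union> set xs"
        using fv_declared_head [OF rsm_resolve(3)] by blast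
      note \<sigma> = matches_sound(2) [OF rsm_resolve(9,7) Un_upper2 this]
      have "typable \<Gamma> e' (tsubst \<sigma> S)" if "(e', S) \<in> set (zip es Ts)" for e' S
      proof (rule IH)
        show "(\<Gamma>, e', tsubst \<sigma> S) \<in> \<Phi>'" using that rsm_resolve(2) eq by force
        show "(\<forall>(h, S) \<in> set \<Gamma>. well_kinded S) \<and> well_kinded (tsubst \<sigma> S)"
          using wk well_kinded_tsubst \<sigma> Ts set_zip_rightD [OF that] by blast
      qed
      then show ?thesis using typable_resolve rsm_resolve(3-) eq by blast
    next
      case (rsm_lam as Ts A \<Delta> e0 \<Phi>0)
      have eq: "\<Delta> = \<Gamma>" "e = lams as e0" "T = timps Ts A" using step.prems(1) False rsm_lam(1,2) by auto
      have Ts: "\<forall>S \<in> set Ts. well_kinded S" "well_kinded A"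
        using wk well_kinded_timps eq by blast+
      have "typable (rev (zip (map EVar as) Ts) @ \<Gamma>) e0 A"
        by (rule IH) (use rsm_lam eq wk Ts in \<open>auto dest: set_zip_rightD\<close>)
      then show ?thesis using typable_lams rsm_lam Ts eq by blast
    next
      case (rsm_forall xs \<Delta> e0 T0 \<Phi>0)
      have eq: "\<Delta> = \<Gamma>" "e = e0" "T = talls xs T0" using step.prems(1) False rsm_forall(1,2) by auto
      have "typable \<Gamma> e T0"
        by (rule IH) (use rsm_forall eq wk well_kinded_talls in auto)
      then show ?thesis using typable_talls rsm_forall eq by blast
    next
      case (rsm_mu \<Delta> a e0 T0 \<Phi>0)
      have eq: "\<Delta> = \<Gamma>" "e = Mu a e0" "T0 = T" using step.prems(1) False rsm_mu(1,2) by auto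
      have "typable ((EVar a, T) # \<Gamma>) e0 T"
        by (rule IH) (use rsm_mu eq wk in auto)
      then show ?thesis
        unfolding typable_def eq using wk t_mu by (metis erase.simps(4))
    qed
  qed
qed

theorem theorem32:
  fixes \<Gamma> :: env and e :: ev and T :: ty
  assumes "curry_style e"
    and "\<forall>(h, S) \<in> set \<Gamma>. well_kinded S \<and> rule_form S \<and> no_exvars S"
    and "well_kinded T" and "rule_form T" and "no_exvars T"
    and "rsm\<^sup>*\<^sup>* {(\<Gamma>, e, T)} {}"
  shows "\<exists>e'. typing \<Gamma> e' T \<and> erase e' = e"
proof -
  have "well_kinded_goal (\<Gamma>, e, T)"
    using assms(2,3) by (auto simp: well_kinded_goal_def)
  with rsm_sound [OF assms(6)] show ?thesis
    by (simp add: typable_def)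
qed

end
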